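(* Let $\mu\geq\nu>-1$. Then the functions $f_{\mu,\nu},g_{\mu,\nu},q_\nu$ defined on $[0,\alpha_{\nu,1}^2)$ by $$g_{\mu,\nu}(x)=x^{\frac{\nu-\mu}{2}}e^{\frac{3x}{4}\left(\frac{1}{\mu+1}-\frac{1}{\nu+1}\right)}\frac{d_\mu(\sqrt{x})}{d_\nu(\sqrt{x})},\qquad f_{\mu,\nu}(x)=\big(\log g_{\mu,\nu}(x)\big)',\qquad q_\nu(x)=\frac{x^{\nu/2}e^{-\frac{3x}{4(\nu+1)}}}{d_\nu(\sqrt{x})},$$ (with values at $x=0$ understood by continuity) are absolutely monotonic on $[0,\alpha_{\nu,1}^2)$.
   Context: $J_\nu$ denotes the Bessel function of the first kind of order $\nu$. The Dini function is $d_\nu(x)=(1-\nu)J_\nu(x)+xJ_\nu'(x)$, and $0<\alpha_{\nu,1}<\alpha_{\nu,2}<\cdots$ denote its positive zeros. For $x>0$, $x^{s}$ denotes the positive real power. Note $x^{-\nu/2}d_\nu(\sqrt x)$ extends to an entire function of $x$ with value $1/(2^\nu\Gamma(\nu+1))$ at $0$. A function $f:I\to\mathbb{R}$ is absolutely monotonic on an interval $I$ if $f^{(n)}(x)\ge0$ for all $x\in I$ and all $n\in\{0,1,2,\dots\}$. *)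

theory Defs
  imports "HOL-Analysis.Analysis"
begin

definition besselJ :: "real \<Rightarrow> real \<Rightarrow> real" where
  "besselJ \<nu> x = (\<Sum>k. (-1) ^ k / (fact k * Gamma (real k + \<nu> + 1)) * (x / 2) powr (2 * real k + \<nu>))"

definition dini :: "real \<Rightarrow> real \<Rightarrow> real" where
  "dini \<nu> x = (1 - \<nu>) * besselJ \<nu> x + x * deriv (besselJ \<nu>) x"

definition dini_zero1 :: "real \<Rightarrow> real" where
  "dini_zero1 \<nu> = Inf {x. 0 < x \<and> dini \<nu> x = 0}"

definition ext0 :: "(real \<Rightarrow> real) \<Rightarrow> real \<Rightarrow> real" where
  "ext0 h x = (if x = 0 then Lim (at_right 0) h else h x)"

definition g_raw :: "real \<Rightarrow> real \<Rightarrow> real \<Rightarrow> real" where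
  "g_raw \<mu> \<nu> x = x powr ((\<nu> - \<mu>) / 2) * exp (3 * x / 4 * (1 / (\<mu> + 1) - 1 / (\<nu> + 1)))
      * dini \<mu> (sqrt x) / dini \<nu> (sqrt x)"

definition f_raw :: "real \<Rightarrow> real \<Rightarrow> real \<Rightarrow> real" where
  "f_raw \<mu> \<nu> x = deriv (\<lambda>t. ln (g_raw \<mu> \<nu> t)) x"

definition q_raw :: "real \<Rightarrow> real \<Rightarrow> real" where
  "q_raw \<nu> x = x powr (\<nu> / 2) * exp (- (3 * x) / (4 * (\<nu> + 1))) / dini \<nu> (sqrt x)"

definition g_fun :: "real \<Rightarrow> real \<Rightarrow> real \<Rightarrow> real" where
  "g_fun \<mu> \<nu> = ext0 (g_raw \<mu> \<nu>)"

definition f_fun :: "real \<Rightarrow> real \<Rightarrow> real \<Rightarrow> real" where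
  "f_fun \<mu> \<nu> = ext0 (f_raw \<mu> \<nu>)"

definition q_fun :: "real \<Rightarrow> real \<Rightarrow> real" where
  "q_fun \<nu> = ext0 (q_raw \<nu>)"

definition absolutely_monotonic_on :: "real set \<Rightarrow> (real \<Rightarrow> real) \<Rightarrow> bool" where
  "absolutely_monotonic_on I f \<longleftrightarrow>
     (\<exists>F :: nat \<Rightarrow> real \<Rightarrow> real.
        (\<forall>x\<in>I. F 0 x = f x) \<and>
        (\<forall>n. \<forall>x\<in>I. (F n has_real_derivative F (Suc n) x) (at x within I)) \<and>
        (\<forall>n. \<forall>x\<in>I. 0 \<le> F n x))"

end

theory Submission
  imports Defs "HOL-Complex_Analysis.Cauchy_Integral_Formula" "HOL-Real_Asymp.Real_Asymp"
begin

text \<open>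
  Let \<open>u\<close> be the normalised Bessel series, so that \<open>\<Delta> = u + 2xu'\<close> is the normalised Dini series.
  The logarithmic derivative \<open>h = -u'/u\<close> satisfies the Riccati equation
  \<open>xh' + (\<nu> + 1)h = xh\<^sup>2 + 1/4\<close>, that is, a recursion which shows that its coefficients are nonnegative and
  decreasing in \<open>\<nu>\<close>. Since \<open>\<Delta> = u(1 - 2xh)\<close>, the same holds for
  \<open>-\<Delta>'/\<Delta> = h + (2xh)'/(1 - 2xh)\<close>, and then for the series \<open>1/\<Delta>\<close>, \<open>q\<close>, \<open>g\<close> and \<open>f\<close> built from it
  once the linear term of the exponent is removed. A Pringsheim-type argument shows that these series
  converge up to the first positive zero of \<open>\<Delta>\<close>; the product expansion of \<open>\<Delta>\<close> is never used.
\<close>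

section \<open>The coefficientwise order on power series\<close>

definition fps_le :: "real fps \<Rightarrow> real fps \<Rightarrow> bool" where
  "fps_le F G \<longleftrightarrow> (\<forall>n. fps_nth F n \<le> fps_nth G n)"

lemma fps_le_nth: "fps_le F G \<Longrightarrow> fps_nth F n \<le> fps_nth G n"
  by (simp add: fps_le_def)

lemma fps_le_0_nth: "fps_le 0 F \<Longrightarrow> 0 \<le> fps_nth F n"
  using fps_le_nth[of 0 F n] by simp

lemma fps_le_add: "fps_le F G \<Longrightarrow> fps_le F' G' \<Longrightarrow> fps_le (F + F') (G + G')"
  by (simp add: fps_le_def add_mono)

lemma fps_le_deriv: "fps_le F G \<Longrightarrow> fps_le (fps_deriv F) (fps_deriv G)"
  by (simp add: fps_le_def mult_left_mono)

lemma fps_le_mult_nth: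
  fixes F F' G G' :: "real fps"
  assumes "\<And>i. i \<le> n \<Longrightarrow> 0 \<le> fps_nth F i \<and> fps_nth F i \<le> fps_nth F' i"
    and "\<And>i. i \<le> n \<Longrightarrow> 0 \<le> fps_nth G i \<and> fps_nth G i \<le> fps_nth G' i"
  shows "0 \<le> fps_nth (F * G) n \<and> fps_nth (F * G) n \<le> fps_nth (F' * G') n"
proof -
  have "0 \<le> fps_nth F i * fps_nth G (n - i) \<and>
      fps_nth F i * fps_nth G (n - i) \<le> fps_nth F' i * fps_nth G' (n - i)" if "i \<le> n" for i
    using assms(1)[of i] assms(2)[of "n - i"] that
    by (intro conjI mult_nonneg_nonneg mult_mono) auto
  then show ?thesis
    unfolding fps_mult_nth by (auto intro!: sum_nonneg sum_mono)
qed

lemma fps_le_mult: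
  assumes "fps_le 0 F" "fps_le F F'" "fps_le 0 G" "fps_le G G'"
  shows "fps_le (F * G) (F' * G')"
proof -
  have "fps_nth (F * G) n \<le> fps_nth (F' * G') n" for n
    using fps_le_mult_nth[of n F F' G G'] assms by (simp add: fps_le_def)
  then show ?thesis by (simp add: fps_le_def)
qed

lemma fps_le_0_mult: "fps_le 0 F \<Longrightarrow> fps_le 0 G \<Longrightarrow> fps_le 0 (F * G)"
  unfolding fps_le_def fps_mult_nth by (auto intro!: sum_nonneg)

text \<open>Coefficient \<open>m + 1\<close> of \<open>Y\<close> is coefficient \<open>m\<close> of
  \<open>F * Y\<close> divided by \<open>m + 1\<close>, so it depends on earlier coefficients only
  and strong induction applies. Taking \<open>Z = Y\<close> and \<open>G = F\<close> gives a
  positivity criterion: a series inherits nonnegative coefficients from its logarithmic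
  derivative.\<close>

lemma fps_le_log_deriv:
  assumes Y: "fps_deriv Y = F * Y" and Z: "fps_deriv Z = G * Z"
    and F: "fps_le 0 F" and FG: "fps_le F G"
    and init: "0 \<le> fps_nth Y 0" "fps_nth Y 0 \<le> fps_nth Z 0"
  shows "fps_le 0 Y" and "fps_le Y Z"
proof -
  have "0 \<le> fps_nth Y n \<and> fps_nth Y n \<le> fps_nth Z n" for n
  proof (induction n rule: less_induct)
    case (less n)
    show ?case
    proof (cases n)
      case (Suc m)
      have "0 \<le> fps_nth (F * Y) m \<and> fps_nth (F * Y) m \<le> fps_nth (G * Z) m"
        using F FG less Suc by (intro fps_le_mult_nth) (auto simp: fps_le_def)
      moreover have "real (Suc m) * fps_nth Y (Suc m) = fps_nth (F * Y) m"
        "real (Suc m) * fps_nth Z (Suc m) = fps_nth (G * Z) m"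
        by (simp_all flip: Y Z)
      ultimately have "0 \<le> real (Suc m) * fps_nth Y (Suc m)"
        "real (Suc m) * fps_nth Y (Suc m) \<le> real (Suc m) * fps_nth Z (Suc m)"
        by simp_all
      then have "0 \<le> fps_nth Y (Suc m)" "fps_nth Y (Suc m) \<le> fps_nth Z (Suc m)"
        by (simp add: zero_le_mult_iff, simp only: mult_le_cancel_left_pos of_nat_0_less_iff zero_less_Suc)
      with Suc show ?thesis by simp
    qed (use init in simp)
  qed
  then show "fps_le 0 Y" "fps_le Y Z" by (simp_all add: fps_le_def)
qed

text \<open>The equations encode \<open>V = 1 / (1 - X F)\<close> and
  \<open>W = 1 / (1 - X G)\<close>. The factor \<open>fps_X\<close> makes every coefficient depend
  on strictly earlier ones.\<close>

lemma fps_le_inverse_one_minus: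
  assumes V: "V = 1 + fps_X * F * V" and W: "W = 1 + fps_X * G * W"
    and F: "fps_le 0 F" and FG: "fps_le F G"
  shows "fps_le 0 V" and "fps_le V W"
proof -
  have "0 \<le> fps_nth V n \<and> fps_nth V n \<le> fps_nth W n" for n
  proof (induction n rule: less_induct)
    case (less n)
    have V': "fps_nth V n = fps_nth (1 + fps_X * (F * V)) n"
      using V by (simp add: mult.assoc)
    have W': "fps_nth W n = fps_nth (1 + fps_X * (G * W)) n"
      using W by (simp add: mult.assoc)
    show ?case
    proof (cases n)
      case (Suc m)
      have "0 \<le> fps_nth (F * V) m \<and> fps_nth (F * V) m \<le> fps_nth (G * W) m"
        using F FG less Suc by (intro fps_le_mult_nth) (auto simp: fps_le_def)
      then show ?thesis using V' W' Suc by simp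
    qed (use V' W' in simp)
  qed
  then show "fps_le 0 V" "fps_le V W" by (simp_all add: fps_le_def)
qed

lemma fps_conv_radius_antimono:
  assumes "fps_le 0 F" "fps_le F G"
  shows "fps_conv_radius G \<le> fps_conv_radius F"
  unfolding fps_conv_radius_def
proof (rule conv_radius_geI_ex')
  fix r :: real assume r: "0 < r" "ereal r < conv_radius (fps_nth G)"
  then have "summable (\<lambda>n. fps_nth G n * r ^ n)"
    by (intro summable_in_conv_radius) auto
  then have "summable (\<lambda>n. fps_nth F n * r ^ n)"
    by (rule summable_comparison_test'[of _ 0])
       (use assms r in \<open>auto simp: fps_le_def abs_mult intro!: mult_right_mono\<close>)
  then show "summable (\<lambda>n. fps_nth F n * of_real r ^ n)" by simp
qed

section \<open>From nonnegative coefficients to absolute monotonicity\<close>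

lemma eval_fps_nonneg:
  assumes "fps_le 0 F" "0 \<le> x" "ereal x < fps_conv_radius F"
  shows "0 \<le> eval_fps F x"
  unfolding eval_fps_def
  using assms by (intro suminf_nonneg summable_fps) (auto simp: fps_le_def)

text \<open>The witnesses are \<open>c\<close> times the iterated formal derivatives of
  \<open>F\<close>: their coefficients stay nonnegative and their radius does not shrink. Agreement
  with \<open>h\<close> is assumed for positive arguments; at 0, \<open>ext0\<close> takes the
  right-hand limit, which continuity of the series supplies.\<close>

lemma absolutely_monotonic_on_ext0_eval_fps:
  assumes nonneg: "fps_le 0 F" and radius: "ereal a \<le> fps_conv_radius F" and "0 \<le> c"
    and h: "\<And>x. 0 < x \<Longrightarrow> x < a \<Longrightarrow> h x = c * eval_fps F x"
  shows "absolutely_monotonic_on {0..<a} (ext0 h)"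
proof -
  define D where "D n = (fps_deriv ^^ n) F" for n
  have D: "fps_le 0 (D n) \<and> fps_conv_radius F \<le> fps_conv_radius (D n)" for n
  proof (induction n)
    case (Suc n)
    then show ?case
      using fps_le_deriv[of 0 "D n"] fps_conv_radius_deriv[of "D n"]
      by (auto simp: D_def intro: order_trans)
  qed (use nonneg in \<open>simp add: D_def\<close>)
  have inside: "ereal \<bar>x\<bar> < fps_conv_radius (D n)" if "x \<in> {0..<a}" for x n
  proof -
    have "ereal \<bar>x\<bar> < ereal a" using that by simp
    also have "\<dots> \<le> fps_conv_radius (D n)" using radius D order_trans by blast
    finally show ?thesis .
  qed
  have base: "c * eval_fps (D 0) x = ext0 h x" if x: "x \<in> {0..<a}" for x
  proof (cases "x = 0")
    case True
    have "isCont (eval_fps (D 0)) 0"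
      using inside[OF x, of 0] True by (intro continuous_eval_fps) simp
    then have "(eval_fps (D 0) \<longlongrightarrow> eval_fps (D 0) 0) (at_right 0)"
      using filterlim_at_split isCont_def by blast
    then have "((\<lambda>x. c * eval_fps (D 0) x) \<longlongrightarrow> c * eval_fps (D 0) 0) (at_right 0)"
      by (rule tendsto_mult_left)
    moreover have "\<forall>\<^sub>F x in at_right 0. x \<in> {0<..<a}"
      using x True by (intro eventually_at_right_real) simp
    then have "\<forall>\<^sub>F x in at_right 0. c * eval_fps (D 0) x = h x"
      by eventually_elim (simp add: h D_def)
    ultimately have "(h \<longlongrightarrow> c * eval_fps (D 0) 0) (at_right 0)"
      by (rule Lim_transform_eventually)
    then have "Lim (at_right 0) h = c * eval_fps (D 0) 0"
      by (intro tendsto_Lim) simp_all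
    then show ?thesis using True by (simp add: ext0_def)
  next
    case False
    then show ?thesis using x h[of x] by (simp add: ext0_def D_def)
  qed
  show ?thesis
    unfolding absolutely_monotonic_on_def
  proof (intro exI[of _ "\<lambda>n x. c * eval_fps (D n) x"] conjI allI ballI)
    fix n x assume x: "x \<in> {0..<a}"
    have "(eval_fps (D n) has_field_derivative eval_fps (fps_deriv (D n)) x) (at x within {0..<a})"
      using inside[OF x] by (intro has_field_derivative_eval_fps) simp
    then show "((\<lambda>x. c * eval_fps (D n) x) has_real_derivative c * eval_fps (D (Suc n)) x)
        (at x within {0..<a})"
      by (intro DERIV_cmult) (simp add: D_def)
    show "0 \<le> c * eval_fps (D n) x"
      using x D inside[OF x, of n] \<open>0 \<le> c\<close> by (intro mult_nonneg_nonneg eval_fps_nonneg) auto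
  qed (use base in simp)
qed

section \<open>Convergence up to the first positive zero\<close>

definition fps_complex :: "real fps \<Rightarrow> complex fps" where
  "fps_complex F = Abs_fps (\<lambda>n. complex_of_real (fps_nth F n))"

lemma fps_complex_nth [simp]: "fps_nth (fps_complex F) n = complex_of_real (fps_nth F n)"
  by (simp add: fps_complex_def)

lemma fps_complex_mult: "fps_complex (F * G) = fps_complex F * fps_complex G"
  by (rule fps_ext) (simp add: fps_mult_nth)

lemma fps_complex_1: "fps_complex 1 = 1"
  by (rule fps_ext) simp

lemma fps_conv_radius_complex: "fps_conv_radius (fps_complex F) = fps_conv_radius F"
  by (simp add: fps_conv_radius_def conv_radius_def)

lemma fps_complex_inverse:
  assumes "fps_nth F 0 \<noteq> 0"
  shows "fps_complex (inverse F) = inverse (fps_complex F)"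
proof -
  have "fps_complex F * fps_complex (inverse F) = 1"
    using assms by (simp add: fps_complex_1 inverse_mult_eq_1' flip: fps_complex_mult)
  then show ?thesis by (metis fps_inverse_unique)
qed

text \<open>A variant of Pringsheim's theorem: if the radius of convergence \<open>r\<close> of \<open>1/f\<close> were less than \<open>a\<close>,
  nonnegativity would force absolute convergence on the closed disc of radius \<open>r\<close>, so \<open>f\<close> would not
  vanish there, hence not on a larger disc either.\<close>

lemma fps_conv_radius_inverse_ge_first_zero:
  fixes f :: "real fps"
  assumes entire: "fps_conv_radius f = \<infinity>" and f0: "fps_nth f 0 \<noteq> 0"
    and nonneg: "fps_le 0 (inverse f)"
    and nz: "\<And>x. 0 \<le> x \<Longrightarrow> x < a \<Longrightarrow> eval_fps f x \<noteq> 0"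
  shows "ereal a \<le> fps_conv_radius (inverse f)"
proof (rule ccontr)
  define p where "p = inverse f"
  assume "\<not> ereal a \<le> fps_conv_radius (inverse f)"
  moreover have "fps_conv_radius p > 0"
    unfolding p_def using entire f0 by (intro fps_conv_radius_inverse_pos) auto
  ultimately obtain r where r: "fps_conv_radius p = ereal r" "0 < r" "r < a"
    by (cases "fps_conv_radius p") (auto simp: p_def)
  have pf: "p * f = 1" using f0 by (simp add: p_def inverse_mult_eq_1)
  have pnn: "0 \<le> fps_nth p n" for n using nonneg by (simp add: p_def fps_le_0_nth)

  \<comment> \<open>For 0 < x < r the series of \<open>p\<close> sums to 1/f(x), so its partial sums
    are at most 1/f(x). Letting x tend to r from the left keeps the bound, since r < a makes f(r)
    nonzero.\<close>
  have partial: "(\<Sum>n<N. fps_nth p n * r ^ n) \<le> inverse (eval_fps f r)" for N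
  proof (rule tendsto_le)
    show "((\<lambda>x. \<Sum>n<N. fps_nth p n * x ^ n) \<longlongrightarrow> (\<Sum>n<N. fps_nth p n * r ^ n)) (at_left r)"
      by (intro tendsto_intros)
    have "isCont (eval_fps f) r" using entire by (intro continuous_eval_fps) simp
    then have "(eval_fps f \<longlongrightarrow> eval_fps f r) (at_left r)"
      using filterlim_at_split isCont_def by blast
    then show "((\<lambda>x. inverse (eval_fps f x)) \<longlongrightarrow> inverse (eval_fps f r)) (at_left r)"
      using nz[of r] r by (intro tendsto_inverse) auto
    have "\<forall>\<^sub>F x in at_left r. x \<in> {0<..<r}"
      using r by (intro eventually_at_left_real) simp
    then show "\<forall>\<^sub>F x in at_left r. (\<Sum>n<N. fps_nth p n * x ^ n) \<le> inverse (eval_fps f x)"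
    proof eventually_elim
      case (elim x)
      have x: "ereal (norm x) < fps_conv_radius p" using elim r by simp
      have "eval_fps p x * eval_fps f x = eval_fps (p * f) x"
        using x entire by (intro eval_fps_mult [symmetric]) simp_all
      then have "inverse (eval_fps f x) = eval_fps p x"
        by (simp add: pf inverse_eq_divide) (metis nonzero_eq_divide_eq mult_zero_right zero_neq_one)
      moreover have "(\<Sum>n<N. fps_nth p n * x ^ n) \<le> eval_fps p x"
        unfolding eval_fps_def using elim pnn x
        by (intro sum_le_suminf summable_fps) auto
      ultimately show ?case by simp
    qed
  qed simp
  have sum_p: "summable (\<lambda>n. fps_nth p n * r ^ n)"
    using partial r pnn by (intro summableI_nonneg_bounded) auto

  \<comment> \<open>Over the complex numbers the radius of a reciprocal is governed by zeros; the
    radii themselves are unchanged, having the same coefficient moduli.\<close>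
  define f' where "f' = fps_complex f"
  define p' where "p' = fps_complex p"
  have entire': "fps_conv_radius f' = \<infinity>" by (simp add: f'_def fps_conv_radius_complex entire)
  have pf': "p' * f' = 1"
    by (simp add: p'_def f'_def pf fps_complex_1 flip: fps_complex_mult)
  \<comment> \<open>On the boundary circle the product rule inside the radius of convergence fails
    to apply. The absolute convergence at r makes the Cauchy product valid there and gives p'(z)
    f'(z) = 1.\<close>
  have nz_cball: "eval_fps f' z \<noteq> 0" if z: "z \<in> cball 0 r" for z
  proof -
    have 1: "summable (\<lambda>n. norm (fps_nth p' n * z ^ n))"
      by (rule summable_comparison_test'[OF sum_p, of 0])
         (use z pnn in \<open>auto simp: p'_def norm_mult norm_power intro!: mult_left_mono power_mono\<close>)
    have 2: "summable (\<lambda>n. norm (fps_nth f' n * z ^ n))"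
      using entire' by (intro norm_summable_fps) simp
    have "eval_fps p' z * eval_fps f' z
        = (\<Sum>k. \<Sum>i\<le>k. (fps_nth p' i * z ^ i) * (fps_nth f' (k - i) * z ^ (k - i)))"
      unfolding eval_fps_def by (rule Cauchy_product[OF 1 2])
    also have "\<dots> = (\<Sum>k. fps_nth (p' * f') k * z ^ k)"
    proof (rule suminf_cong)
      fix k
      have "(\<Sum>i\<le>k. (fps_nth p' i * z ^ i) * (fps_nth f' (k - i) * z ^ (k - i)))
          = (\<Sum>i\<le>k. fps_nth p' i * fps_nth f' (k - i) * z ^ k)"
      proof (rule sum.cong)
        fix i assume "i \<in> {..k}"
        then have "z ^ k = z ^ i * z ^ (k - i)" by (simp flip: power_add)
        then show "(fps_nth p' i * z ^ i) * (fps_nth f' (k - i) * z ^ (k - i))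
            = fps_nth p' i * fps_nth f' (k - i) * z ^ k" by simp
      qed simp
      then show "(\<Sum>i\<le>k. (fps_nth p' i * z ^ i) * (fps_nth f' (k - i) * z ^ (k - i)))
          = fps_nth (p' * f') k * z ^ k"
        by (simp add: fps_mult_nth sum_distrib_right atLeast0AtMost)
    qed
    also have "\<dots> = 1" unfolding pf' using eval_fps_1[of z] by (simp add: eval_fps_def)
    finally show ?thesis by auto
  qed

  \<comment> \<open>The closed zero set misses the compact disc, hence stays at some distance d > 0
    from it.\<close>
  have "closed {z. eval_fps f' z = 0}"
    by (intro closed_Collect_eq continuous_intros) (simp_all add: entire')
  moreover have "cball 0 r \<inter> {z. eval_fps f' z = 0} = {}" using nz_cball by blast
  ultimately have "\<exists>d>0. \<forall>y\<in>cball 0 r. \<forall>z\<in>{z. eval_fps f' z = 0}. d \<le> dist y z"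
    by (intro separate_compact_closed) simp_all
  then obtain d where d: "d > 0" "\<And>y z. y \<in> cball 0 r \<Longrightarrow> eval_fps f' z = 0 \<Longrightarrow> d \<le> dist y z"
    by blast
  have nz_ball: "eval_fps f' z \<noteq> 0" if z: "norm z < r + d" for z
  proof
    assume 0: "eval_fps f' z = 0"
    then have zr: "r < norm z" using nz_cball[of z] by force
    \<comment> \<open>The radial projection of z onto the circle of radius r lies at distance
      \<open>norm z - r\<close>, which is less than d.\<close>
    define y where "y = of_real (r / norm z) * z"
    have "norm y = \<bar>r / norm z\<bar> * norm z" unfolding y_def norm_mult norm_of_real ..
    moreover have z0: "z \<noteq> 0" using zr r(2) by auto
    ultimately have "norm y = r" using r(2) by simp
    then have "d \<le> dist y z" using d(2)[of y z] 0 by simp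
    also have "z - y = of_real (1 - r / norm z) * z" by (simp add: y_def algebra_simps)
    then have "dist y z = \<bar>1 - r / norm z\<bar> * norm z"
      by (metis dist_commute dist_norm norm_mult norm_of_real)
    also have "\<dots> = norm z - r" using zr z0 by (simp add: abs_if field_simps)
    finally show False using z by simp
  qed
  \<comment> \<open>A zero-free disc of radius r + d pushes the radius of \<open>p\<close> beyond r,
    contradicting the choice of r.\<close>
  have "min (ereal (r + d)) (fps_conv_radius f') \<le> fps_conv_radius (inverse f')"
    by (rule fps_conv_radius_inverse) (use nz_ball in simp)
  then have "ereal (r + d) \<le> fps_conv_radius p"
    using f0 by (simp add: entire f'_def p_def fps_conv_radius_complex flip: fps_complex_inverse)
  with r d show False by simp
qed

section \<open>Bessel and Dini power series\<close>

text \<open>The normalised series \<open>2\<^sup>\<nu> \<Gamma>(\<nu> + 1) x\<^bsup>-\<nu>/2\<^esup> J\<^sub>\<nu>(\<surd>x)\<close>.\<close>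

definition bessel_fps :: "real \<Rightarrow> real fps" where
  "bessel_fps \<nu> = Abs_fps (\<lambda>k. (-1) ^ k / (4 ^ k * fact k * pochhammer (\<nu> + 1) k))"

text \<open>In the variable x = t^2 the operator t d/dt becomes 2x d/dx. Acting on the factor
  t^\<nu> it also contributes \<nu>, which cancels the -\<nu> in the Dini function.\<close>

definition dini_fps :: "real \<Rightarrow> real fps" where
  "dini_fps \<nu> = bessel_fps \<nu> + 2 * fps_X * fps_deriv (bessel_fps \<nu>)"

lemma bessel_fps_nth_0 [simp]: "fps_nth (bessel_fps \<nu>) 0 = 1"
  by (simp add: bessel_fps_def)

lemma dini_fps_nth_0 [simp]: "fps_nth (dini_fps \<nu>) 0 = 1"
  by (simp add: dini_fps_def)

text \<open>This recurrence serves both the ratio test for the infinite radius and the differential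
  equation.\<close>

lemma bessel_fps_nth_Suc:
  assumes "\<nu> > -1"
  shows "(real n + 1) * (real n + \<nu> + 1) * fps_nth (bessel_fps \<nu>) (Suc n) = - fps_nth (bessel_fps \<nu>) n / 4"
proof -
  have "\<nu> + 1 + real n \<noteq> 0" "pochhammer (\<nu> + 1) n \<noteq> 0"
    using assms pochhammer_pos[of "\<nu> + 1" n] by auto
  then show ?thesis
    by (simp add: bessel_fps_def pochhammer_Suc divide_simps) (simp add: algebra_simps)
qed

lemma fps_conv_radius_bessel_fps [simp]:
  assumes "\<nu> > -1"
  shows "fps_conv_radius (bessel_fps \<nu>) = \<infinity>"
  unfolding fps_conv_radius_def
proof (rule conv_radius_ratio_limit_ereal_nonzero)
  let ?u = "fps_nth (bessel_fps \<nu>)"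
  have "norm (?u n) / norm (?u (Suc n)) = 4 * (real n + 1) * (real n + \<nu> + 1)" for n
  proof -
    have "?u (Suc n) \<noteq> 0"
      using assms pochhammer_pos[of "\<nu> + 1" "Suc n"] by (simp add: bessel_fps_def)
    moreover have "?u n = - (4 * (real n + 1) * (real n + \<nu> + 1)) * ?u (Suc n)"
      using bessel_fps_nth_Suc[OF assms, of n] by (simp add: algebra_simps)
    ultimately show ?thesis using assms by (simp add: abs_mult)
  qed
  moreover have "filterlim (\<lambda>n. 4 * (real n + 1) * (real n + \<nu> + 1)) at_top sequentially"
    by real_asymp
  ultimately show "(\<lambda>n. ereal (norm (?u n) / norm (?u (Suc n)))) \<longlonglongrightarrow> \<infinity>"
    by (simp add: tendsto_PInfty_eq_at_top)
qed simp

lemma fps_conv_radius_bessel_fps_deriv [simp]: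
  "\<nu> > -1 \<Longrightarrow> fps_conv_radius (fps_deriv (bessel_fps \<nu>)) = \<infinity>"
  using fps_conv_radius_deriv[of "bessel_fps \<nu>"] by simp

lemma fps_conv_radius_mult_infinity:
  "fps_conv_radius F = \<infinity> \<Longrightarrow> fps_conv_radius G = \<infinity> \<Longrightarrow> fps_conv_radius (F * G) = \<infinity>"
  using fps_conv_radius_mult[of F G] by simp

lemma fps_conv_radius_dini_fps [simp]:
  assumes "\<nu> > -1"
  shows "fps_conv_radius (dini_fps \<nu>) = \<infinity>"
proof -
  have "fps_conv_radius (2 * fps_X * fps_deriv (bessel_fps \<nu>)) = \<infinity>"
    using assms by (intro fps_conv_radius_mult_infinity) simp_all
  then show ?thesis
    using assms fps_conv_radius_add[of "bessel_fps \<nu>" "2 * fps_X * fps_deriv (bessel_fps \<nu>)"]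
    by (simp add: dini_fps_def)
qed

lemma eval_dini_fps:
  assumes "\<nu> > -1"
  shows "eval_fps (dini_fps \<nu>) x = eval_fps (bessel_fps \<nu>) x + 2 * x * eval_fps (fps_deriv (bessel_fps \<nu>)) x"
proof -
  have "fps_conv_radius (2 * fps_X * fps_deriv (bessel_fps \<nu>)) = \<infinity>" "fps_conv_radius (2 * fps_X :: real fps) = \<infinity>"
    using assms by (simp_all add: fps_conv_radius_mult_infinity)
  then show ?thesis
    using assms by (simp add: dini_fps_def eval_fps_add eval_fps_mult)
qed

section \<open>Identification with the Bessel and Dini functions\<close>

lemma besselJ_eq_eval_fps:
  assumes "\<nu> > -1" "x > 0"
  shows "besselJ \<nu> x = (x / 2) powr \<nu> / Gamma (\<nu> + 1) * eval_fps (bessel_fps \<nu>) (x\<^sup>2)"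
proof -
  have G: "Gamma (\<nu> + 1) > 0" using assms by (intro Gamma_real_pos) simp
  have "(\<lambda>k. (x / 2) powr \<nu> / Gamma (\<nu> + 1) * (fps_nth (bessel_fps \<nu>) k * (x\<^sup>2) ^ k)) sums
     ((x / 2) powr \<nu> / Gamma (\<nu> + 1) * eval_fps (bessel_fps \<nu>) (x\<^sup>2))"
    using assms by (intro sums_mult sums_eval_fps) simp
  also have "(\<lambda>k. (x / 2) powr \<nu> / Gamma (\<nu> + 1) * (fps_nth (bessel_fps \<nu>) k * (x\<^sup>2) ^ k))
     = (\<lambda>k. (-1) ^ k / (fact k * Gamma (real k + \<nu> + 1)) * (x / 2) powr (2 * real k + \<nu>))"
  proof
    fix k
    have "\<nu> + 1 \<notin> \<int>\<^sub>\<le>\<^sub>0" using assms by (auto elim!: nonpos_Ints_cases)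
    then have "Gamma (real k + \<nu> + 1) = Gamma (\<nu> + 1) * pochhammer (\<nu> + 1) k"
      using G by (simp add: pochhammer_Gamma add_ac)
    moreover have "(x / 2) powr (2 * real k + \<nu>) = (x\<^sup>2) ^ k / 4 ^ k * (x / 2) powr \<nu>"
    proof -
      have "(x / 2) powr (2 * real k) = (x / 2) ^ (2 * k)"
        using assms powr_realpow[of "x / 2" "2 * k"] by simp
      also have "\<dots> = (x\<^sup>2) ^ k / 4 ^ k" by (simp add: power_mult power_divide)
      finally show ?thesis by (simp add: powr_add)
    qed
    ultimately show "(x / 2) powr \<nu> / Gamma (\<nu> + 1) * (fps_nth (bessel_fps \<nu>) k * (x\<^sup>2) ^ k)
      = (-1) ^ k / (fact k * Gamma (real k + \<nu> + 1)) * (x / 2) powr (2 * real k + \<nu>)"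
      by (simp add: bessel_fps_def mult_ac)
  qed
  finally show ?thesis by (simp add: besselJ_def sums_iff)
qed

lemma dini_eq_eval_fps:
  assumes "\<nu> > -1" "x > 0"
  shows "dini \<nu> x = (x / 2) powr \<nu> / Gamma (\<nu> + 1) * eval_fps (dini_fps \<nu>) (x\<^sup>2)"
proof -
  let ?u = "eval_fps (bessel_fps \<nu>)" and ?u' = "eval_fps (fps_deriv (bessel_fps \<nu>))"
  define C where "C = (x / 2) powr \<nu> / Gamma (\<nu> + 1)"
  have G: "Gamma (\<nu> + 1) \<noteq> 0" using assms Gamma_real_pos[of "\<nu> + 1"] by linarith
  have u: "(?u has_real_derivative ?u' (x\<^sup>2)) (at (x\<^sup>2))"
    using assms by (intro has_field_derivative_eval_fps) simp
  have u2: "((\<lambda>t. ?u (t\<^sup>2)) has_real_derivative ?u' (x\<^sup>2) * (2 * x)) (at x)"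
    by (rule DERIV_chain2[where f = ?u and g = "\<lambda>t. t\<^sup>2", OF u])
       (auto intro!: derivative_eq_intros)
  have "((\<lambda>t. (t / 2) powr \<nu> / Gamma (\<nu> + 1)) has_real_derivative C * \<nu> / x) (at x)"
    using assms unfolding C_def
    by (auto intro!: derivative_eq_intros simp: powr_diff mult_ac dest: notE[OF G])
  then have "((\<lambda>t. (t / 2) powr \<nu> / Gamma (\<nu> + 1) * ?u (t\<^sup>2)) has_real_derivative
      C * \<nu> / x * ?u (x\<^sup>2) + ?u' (x\<^sup>2) * (2 * x) * C) (at x)"
    unfolding C_def by (rule DERIV_mult[OF _ u2, unfolded C_def])
  \<comment> \<open>The series formula holds on the open half-line, which suffices to transfer the
    derivative at a positive point.\<close>
  then have "(besselJ \<nu> has_real_derivative C * \<nu> / x * ?u (x\<^sup>2) + ?u' (x\<^sup>2) * (2 * x) * C) (at x)"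
    by (rule has_field_derivative_transform_within_open[where S = "{0<..}"])
       (use assms in \<open>auto simp: besselJ_eq_eval_fps\<close>)
  then have "deriv (besselJ \<nu>) x = C * \<nu> / x * ?u (x\<^sup>2) + ?u' (x\<^sup>2) * (2 * x) * C"
    by (rule DERIV_imp_deriv)
  then show ?thesis
    using assms
    by (simp add: dini_def besselJ_eq_eval_fps eval_dini_fps flip: C_def)
       (simp add: algebra_simps power2_eq_square)
qed

text \<open>The value at 0 of the entire extension of x^(-\<nu>/2) d_\<nu>(sqrt x).\<close>

definition dini_const :: "real \<Rightarrow> real" where
  "dini_const \<nu> = 1 / (2 powr \<nu> * Gamma (\<nu> + 1))"

lemma dini_const_pos: "\<nu> > -1 \<Longrightarrow> dini_const \<nu> > 0"
  unfolding dini_const_def by (simp add: Gamma_real_pos)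

lemma dini_sqrt:
  assumes "\<nu> > -1" "x > 0"
  shows "dini \<nu> (sqrt x) = dini_const \<nu> * x powr (\<nu> / 2) * eval_fps (dini_fps \<nu>) x"
proof -
  have "(sqrt x / 2) powr \<nu> = x powr (\<nu> / 2) / 2 powr \<nu>"
    using assms by (simp add: powr_divide powr_powr flip: powr_half_sqrt)
  then show ?thesis
    using assms by (simp add: dini_eq_eval_fps dini_const_def)
qed

lemma eval_dini_fps_nonzero:
  assumes "\<nu> > -1" "0 \<le> x" "x < (dini_zero1 \<nu>)\<^sup>2"
  shows "eval_fps (dini_fps \<nu>) x \<noteq> 0"
proof (cases "x = 0")
  case False
  show ?thesis
  proof
    assume "eval_fps (dini_fps \<nu>) x = 0"
    with False assms have "sqrt x \<in> {x. 0 < x \<and> dini \<nu> x = 0}" by (simp add: dini_sqrt)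
    \<comment> \<open>The set of zeros contains \<open>sqrt x\<close>, so it is nonempty and its
      infimum is at least 0; this allows the inequality to be squared.\<close>
    then have "dini_zero1 \<nu> \<le> sqrt x" "0 \<le> dini_zero1 \<nu>"
      unfolding dini_zero1_def
      by (auto intro!: cInf_lower cInf_greatest bdd_belowI[of _ 0] simp del: real_sqrt_gt_0_iff)
    then have "(dini_zero1 \<nu>)\<^sup>2 \<le> (sqrt x)\<^sup>2" by (rule power_mono)
    with assms show False by simp
  qed
qed (simp add: eval_fps_at_0)

section \<open>Monotonicity in the order\<close>

text \<open>For \<nu> > -1 the coefficients are the Rayleigh sums of j^(-2(n+1)) over the positive
  zeros j of J_\<nu>; the minus sign makes them positive.\<close>

definition bessel_log_deriv :: "real \<Rightarrow> real fps" where
  "bessel_log_deriv \<nu> = - fps_deriv (bessel_fps \<nu>) * inverse (bessel_fps \<nu>)"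

definition dini_log_deriv :: "real \<Rightarrow> real fps" where
  "dini_log_deriv \<nu> = - fps_deriv (dini_fps \<nu>) * inverse (dini_fps \<nu>)"

lemma bessel_log_deriv_mult: "bessel_log_deriv \<nu> * bessel_fps \<nu> = - fps_deriv (bessel_fps \<nu>)"
  by (simp add: bessel_log_deriv_def mult.assoc inverse_mult_eq_1)

lemma dini_log_deriv_mult: "dini_log_deriv \<nu> * dini_fps \<nu> = - fps_deriv (dini_fps \<nu>)"
  by (simp add: dini_log_deriv_def mult.assoc inverse_mult_eq_1)

text \<open>Bessel's equation in the squared variable with the power factor removed; coefficientwise
  it is the recurrence above.\<close>

lemma bessel_fps_ode:
  assumes "\<nu> > -1"
  shows "fps_X * fps_deriv (fps_deriv (bessel_fps \<nu>)) + fps_const (\<nu> + 1) * fps_deriv (bessel_fps \<nu>)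
    + fps_const (1 / 4) * bessel_fps \<nu> = 0"
proof (rule fps_ext)
  fix n
  show "fps_nth (fps_X * fps_deriv (fps_deriv (bessel_fps \<nu>)) + fps_const (\<nu> + 1) * fps_deriv (bessel_fps \<nu>)
    + fps_const (1 / 4) * bessel_fps \<nu>) n = fps_nth 0 n"
    using bessel_fps_nth_Suc[OF assms, of n] by (cases n) (simp_all add: algebra_simps)
qed

text \<open>Substituting u' = -hu and u'' = (h^2 - h')u into the differential equation leaves a
  multiple of u, which cancels because power series form an integral domain.\<close>

lemma bessel_log_deriv_riccati:
  assumes "\<nu> > -1"
  shows "fps_X * fps_deriv (bessel_log_deriv \<nu>) + fps_const (\<nu> + 1) * bessel_log_deriv \<nu>
    = fps_X * (bessel_log_deriv \<nu> * bessel_log_deriv \<nu>) + fps_const (1 / 4)"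
proof -
  define U where "U = bessel_fps \<nu>"
  define H where "H = bessel_log_deriv \<nu>"
  have U0: "U \<noteq> 0" using bessel_fps_nth_0[of \<nu>] by (auto simp: U_def simp del: bessel_fps_nth_0)
  have HU: "fps_deriv U = - (H * U)" by (simp add: U_def H_def bessel_log_deriv_mult)
  have "fps_deriv (fps_deriv U) = - (H * fps_deriv U + fps_deriv H * U)"
    by (subst HU) simp
  also have "\<dots> = H * H * U - fps_deriv H * U"
    by (simp add: HU algebra_simps)
  finally have "fps_X * (H * H * U - fps_deriv H * U) + fps_const (\<nu> + 1) * (- (H * U))
    + fps_const (1 / 4) * U = 0"
    using bessel_fps_ode[OF assms] by (simp only: HU flip: U_def)
  then have "(fps_X * fps_deriv H + fps_const (\<nu> + 1) * H) * U
      = (fps_X * (H * H) + fps_const (1 / 4)) * U"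
    by (simp only: ring_distribs mult_minus_right add_uminus_conv_diff)
       (simp only: algebra_simps add_0)
  with U0 show ?thesis by (simp add: H_def)
qed

text \<open>On the left of the Riccati equation coefficient n is multiplied by n + \<nu> + 1; on the
  right only coefficients below n occur, so this is a recursion.\<close>

lemma bessel_log_deriv_nth:
  assumes "\<nu> > -1"
  shows "(real n + \<nu> + 1) * fps_nth (bessel_log_deriv \<nu>) n
    = fps_nth (fps_X * (bessel_log_deriv \<nu> * bessel_log_deriv \<nu>) + fps_const (1 / 4)) n"
  unfolding bessel_log_deriv_riccati[OF assms, symmetric]
  by (cases n) (simp_all add: algebra_simps)

lemma bessel_log_deriv_antimono:
  assumes "\<nu> > -1" "\<mu> \<ge> \<nu>"
  shows "fps_le 0 (bessel_log_deriv \<mu>)" and "fps_le (bessel_log_deriv \<mu>) (bessel_log_deriv \<nu>)"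
proof -
  define H where "H = bessel_log_deriv"
  have "0 \<le> fps_nth (H \<mu>) n \<and> fps_nth (H \<mu>) n \<le> fps_nth (H \<nu>) n" for n
  proof (induction n rule: less_induct)
    case (less n)
    \<comment> \<open>\<open>A\<close> is the numerator in the recursion: 1/4 for n = 0, and
      otherwise a convolution of earlier coefficients. A smaller order enlarges it and shrinks the
      positive denominator.\<close>
    define A where "A \<nu> = fps_nth (fps_X * (H \<nu> * H \<nu>) + fps_const (1 / 4)) n" for \<nu>
    have A: "0 \<le> A \<mu> \<and> A \<mu> \<le> A \<nu>"
    proof (cases n)
      case (Suc m)
      have "0 \<le> fps_nth (H \<mu> * H \<mu>) m \<and> fps_nth (H \<mu> * H \<mu>) m \<le> fps_nth (H \<nu> * H \<nu>) m"
        using less Suc by (intro fps_le_mult_nth) auto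
      with Suc show ?thesis by (simp add: A_def)
    qed (simp add: A_def)
    have "fps_nth (H \<mu>) n = A \<mu> / (real n + \<mu> + 1)" "fps_nth (H \<nu>) n = A \<nu> / (real n + \<nu> + 1)"
      using bessel_log_deriv_nth[of \<mu> n] bessel_log_deriv_nth[of \<nu> n] assms
      by (simp_all add: A_def H_def field_simps)
    moreover have "A \<mu> / (real n + \<mu> + 1) \<le> A \<nu> / (real n + \<nu> + 1)"
      using A assms by (intro frac_le) auto
    ultimately show ?case using A assms by simp
  qed
  then show "fps_le 0 (bessel_log_deriv \<mu>)" "fps_le (bessel_log_deriv \<mu>) (bessel_log_deriv \<nu>)"
    by (simp_all add: fps_le_def H_def)
qed

lemma dini_log_deriv_eq:
  fixes \<nu> defines "W \<equiv> fps_X * (2 * bessel_log_deriv \<nu>)"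
  shows "dini_log_deriv \<nu> = bessel_log_deriv \<nu> + fps_deriv W * inverse (1 - W)"
proof -
  define U where "U = bessel_fps \<nu>"
  define H where "H = bessel_log_deriv \<nu>"
  define D where "D = dini_fps \<nu>"
  define V where "V = inverse (1 - W)"
  have V: "V * (1 - W) = 1" unfolding V_def by (rule inverse_mult_eq_1) (simp add: W_def)
  have D0: "D \<noteq> 0" using dini_fps_nth_0[of \<nu>] by (auto simp: D_def simp del: dini_fps_nth_0)
  have HU: "fps_deriv U = - (H * U)" by (simp add: U_def H_def bessel_log_deriv_mult)
  have D: "D = (1 - W) * U"
    by (simp add: D_def dini_fps_def HU W_def algebra_simps flip: U_def H_def)
  have "dini_log_deriv \<nu> * D = - fps_deriv D" by (simp add: D_def dini_log_deriv_mult)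
  \<comment> \<open>Inserting \<open>V * (1 - W) = 1\<close> lets D = (1 - W)U be factored out and
    then cancelled.\<close>
  also have "\<dots> = H * D + fps_deriv W * (V * (1 - W)) * U"
    by (simp add: D HU V)
  also have "\<dots> = (H + fps_deriv W * V) * D" by (simp add: D algebra_simps)
  finally show ?thesis using D0 by (simp add: H_def V_def)
qed

text \<open>The series h, (2xh)' and 1/(1 - 2xh) are nonnegative and decreasing in the order, and
  sums and products preserve both properties.\<close>

lemma dini_log_deriv_antimono:
  assumes "\<nu> > -1" "\<mu> \<ge> \<nu>"
  shows "fps_le 0 (dini_log_deriv \<mu>)" and "fps_le (dini_log_deriv \<mu>) (dini_log_deriv \<nu>)"
proof -
  define F where "F \<nu> = 2 * bessel_log_deriv \<nu>" for \<nu>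
  define V where "V \<nu> = inverse (1 - fps_X * F \<nu>)" for \<nu>
  note H = bessel_log_deriv_antimono[OF assms]
  have F: "fps_le 0 (F \<mu>)" "fps_le (F \<mu>) (F \<nu>)"
    using H by (simp_all add: F_def fps_le_def fps_numeral_nth numeral_fps_const)
  have V_rec: "V \<nu> = 1 + fps_X * F \<nu> * V \<nu>" for \<nu>
  proof -
    have "(1 - fps_X * F \<nu>) * V \<nu> = 1" unfolding V_def by (rule inverse_mult_eq_1') simp
    then show ?thesis by (simp add: algebra_simps)
  qed
  note V = fps_le_inverse_one_minus[OF V_rec V_rec F]
  have XF: "fps_le 0 (fps_X * F \<mu>)" "fps_le (fps_X * F \<mu>) (fps_X * F \<nu>)"
    using F by (auto simp: fps_le_def)
  have XF': "fps_le 0 (fps_deriv (fps_X * F \<mu>))"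
    "fps_le (fps_deriv (fps_X * F \<mu>)) (fps_deriv (fps_X * F \<nu>))"
    using fps_le_deriv[OF XF(1)] fps_le_deriv[OF XF(2)] by simp_all
  have eq: "dini_log_deriv \<nu> = bessel_log_deriv \<nu> + fps_deriv (fps_X * F \<nu>) * V \<nu>" for \<nu>
    unfolding V_def F_def by (rule dini_log_deriv_eq)
  show "fps_le 0 (dini_log_deriv \<mu>)"
    using fps_le_add[OF H(1) fps_le_0_mult[OF XF'(1) V(1)]] by (simp add: eq)
  show "fps_le (dini_log_deriv \<mu>) (dini_log_deriv \<nu>)"
    unfolding eq by (rule fps_le_add[OF H(2) fps_le_mult[OF XF' V]])
qed

text \<open>This constant is the source of the factor 3/4 in the exponentials of g and q, which
  remove it from the logarithmic derivatives.\<close>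

lemma dini_log_deriv_nth_0: "fps_nth (dini_log_deriv \<nu>) 0 = 3 / (4 * (\<nu> + 1))"
  by (simp add: dini_log_deriv_def dini_fps_def bessel_fps_def fps_numeral_nth numeral_fps_const mult.assoc)

section \<open>The reciprocal Dini series and its radius of convergence\<close>

lemma fps_deriv_inverse_dini_fps:
  "fps_deriv (inverse (dini_fps \<nu>)) = dini_log_deriv \<nu> * inverse (dini_fps \<nu>)"
  by (simp add: fps_inverse_deriv dini_log_deriv_def power2_eq_square mult.assoc)

lemma inverse_dini_fps_antimono:
  assumes "\<nu> > -1" "\<mu> \<ge> \<nu>"
  shows "fps_le 0 (inverse (dini_fps \<mu>))" and "fps_le (inverse (dini_fps \<mu>)) (inverse (dini_fps \<nu>))"
  using fps_le_log_deriv[OF fps_deriv_inverse_dini_fps fps_deriv_inverse_dini_fps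
      dini_log_deriv_antimono[OF assms]] by simp_all

text \<open>For the order \<nu> the Pringsheim argument applies. For \<mu> the coefficients are
  nonnegative and no larger, so the radius is no smaller.\<close>

lemma inverse_dini_fps_radius:
  assumes "\<nu> > -1" "\<mu> \<ge> \<nu>"
  shows "ereal ((dini_zero1 \<nu>)\<^sup>2) \<le> fps_conv_radius (inverse (dini_fps \<mu>))"
proof -
  have "ereal ((dini_zero1 \<nu>)\<^sup>2) \<le> fps_conv_radius (inverse (dini_fps \<nu>))"
    using assms eval_dini_fps_nonzero[of \<nu>] inverse_dini_fps_antimono(1)[of \<nu> \<nu>]
    by (intro fps_conv_radius_inverse_ge_first_zero) auto
  also have "\<dots> \<le> fps_conv_radius (inverse (dini_fps \<mu>))"
    using fps_conv_radius_antimono inverse_dini_fps_antimono assms by blast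
  finally show ?thesis .
qed

lemma dini_log_deriv_radius:
  assumes "\<nu> > -1" "\<mu> \<ge> \<nu>"
  shows "ereal ((dini_zero1 \<nu>)\<^sup>2) \<le> fps_conv_radius (dini_log_deriv \<mu>)"
proof -
  have "fps_conv_radius (fps_deriv (dini_fps \<mu>)) = \<infinity>"
    using fps_conv_radius_deriv[of "dini_fps \<mu>"] assms by simp
  then show ?thesis
    using fps_conv_radius_mult[of "- fps_deriv (dini_fps \<mu>)" "inverse (dini_fps \<mu>)"]
      inverse_dini_fps_radius[OF assms] order_trans
    by (auto simp: dini_log_deriv_def)
qed

text \<open>The reciprocal series is nonnegative and its product with \<Delta> is 1, so both are
  positive. With \<mu> > \<nu> this covers the numerator of g on an interval set by \<nu>.\<close>

lemma eval_dini_fps_pos: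
  assumes "\<nu> > -1" "\<mu> \<ge> \<nu>" "0 \<le> x" "x < (dini_zero1 \<nu>)\<^sup>2"
  shows "eval_fps (dini_fps \<mu>) x > 0"
    and "eval_fps (inverse (dini_fps \<mu>)) x = 1 / eval_fps (dini_fps \<mu>) x"
proof -
  let ?D = "dini_fps \<mu>"
  have "ereal x < ereal ((dini_zero1 \<nu>)\<^sup>2)" using assms by simp
  also note inverse_dini_fps_radius[OF assms(1,2)]
  finally have x: "ereal x < fps_conv_radius (inverse ?D)" .
  have "eval_fps (inverse ?D) x * eval_fps ?D x = eval_fps (inverse ?D * ?D) x"
    using x assms by (intro eval_fps_mult [symmetric]) simp_all
  then have 1: "eval_fps (inverse ?D) x * eval_fps ?D x = 1" by (simp add: inverse_mult_eq_1)
  moreover have "0 \<le> eval_fps (inverse ?D) x"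
    using inverse_dini_fps_antimono(1)[OF assms(1,2)] assms(3) x by (rule eval_fps_nonneg)
  ultimately show "eval_fps ?D x > 0"
    by (metis less_eq_real_def mult_zero_left zero_less_mult_pos zero_less_one zero_neq_one)
  with 1 show "eval_fps (inverse ?D) x = 1 / eval_fps ?D x" by (simp add: field_simps)
qed

section \<open>Absolute monotonicity\<close>

lemma absolutely_monotonic_q_fun:
  assumes "\<nu> > -1"
  shows "absolutely_monotonic_on {0..<(dini_zero1 \<nu>)\<^sup>2} (q_fun \<nu>)"
proof -
  define c where "c = 3 / (4 * (\<nu> + 1))"
  define P where "P = inverse (dini_fps \<nu>)"
  define Q where "Q = P * fps_exp (- c)"
  define E where "E = dini_log_deriv \<nu> - fps_const c"
  have "fps_le 0 (dini_log_deriv \<nu>)" using dini_log_deriv_antimono[of \<nu> \<nu>] assms by simp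
  \<comment> \<open>Subtracting c changes the constant coefficient alone, which becomes exactly
    0.\<close>
  then have E: "fps_le 0 E"
    unfolding fps_le_def E_def
    by (auto simp: dini_log_deriv_nth_0 c_def)
  have "fps_deriv Q = E * Q"
    by (simp add: Q_def P_def E_def fps_deriv_inverse_dini_fps flip: fps_const_neg)
       (simp add: algebra_simps)
  then have Q: "fps_le 0 Q"
    using fps_le_log_deriv(1)[of Q E Q E] E by (simp add: fps_le_def Q_def P_def)
  have radP: "ereal ((dini_zero1 \<nu>)\<^sup>2) \<le> fps_conv_radius P"
    unfolding P_def using assms by (intro inverse_dini_fps_radius) auto
  also have "\<dots> \<le> fps_conv_radius Q"
    unfolding Q_def using fps_conv_radius_mult[of P "fps_exp (- c)"] by simp
  finally have radius: "ereal ((dini_zero1 \<nu>)\<^sup>2) \<le> fps_conv_radius Q" .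
  show ?thesis
    unfolding q_fun_def
  proof (rule absolutely_monotonic_on_ext0_eval_fps[OF Q radius])
    show "0 \<le> 1 / dini_const \<nu>" using dini_const_pos[OF assms] by simp
    fix x assume x: "0 < x" "x < (dini_zero1 \<nu>)\<^sup>2"
    then have "ereal x < ereal ((dini_zero1 \<nu>)\<^sup>2)" by simp
    also note radP
    finally have "eval_fps Q x = eval_fps P x * exp (- c * x)"
      using x by (simp add: Q_def eval_fps_mult)
    also have "\<dots> = exp (- (3 * x) / (4 * (\<nu> + 1))) / eval_fps (dini_fps \<nu>) x"
      using eval_dini_fps_pos(2)[of \<nu> \<nu> x] assms x by (simp add: P_def c_def)
    finally show "q_raw \<nu> x = 1 / dini_const \<nu> * eval_fps Q x"
      using x assms by (simp add: q_raw_def dini_sqrt)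
  qed
qed

text \<open>Up to a positive constant g is the series \<open>K\<close>, and f is its logarithmic
  derivative \<open>E\<close>. Nonnegativity of \<open>E\<close> comes from monotonicity in the
  order, and K' = EK passes it on to \<open>K\<close>.\<close>

lemma absolutely_monotonic_f_fun_g_fun:
  assumes "\<nu> > -1" "\<mu> \<ge> \<nu>"
  shows "absolutely_monotonic_on {0..<(dini_zero1 \<nu>)\<^sup>2} (f_fun \<mu> \<nu>)"
    and "absolutely_monotonic_on {0..<(dini_zero1 \<nu>)\<^sup>2} (g_fun \<mu> \<nu>)"
proof -
  define R where "R = (dini_zero1 \<nu>)\<^sup>2"
  define c where "c = 3 / (4 * (\<mu> + 1)) - 3 / (4 * (\<nu> + 1))"
  define C where "C = dini_const \<mu> / dini_const \<nu>"
  define P where "P = inverse (dini_fps \<nu>)"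
  define K where "K = dini_fps \<mu> * P * fps_exp c"
  define E where "E = dini_log_deriv \<nu> - dini_log_deriv \<mu> + fps_const c"
  have C: "C > 0" using assms by (simp add: C_def dini_const_pos)
  \<comment> \<open>The choice of c makes the constant coefficient vanish; the higher ones are
    differences that are nonnegative since \<mu> \<ge> \<nu>.\<close>
  have E: "fps_le 0 E"
    unfolding fps_le_def E_def
    using fps_le_nth[OF dini_log_deriv_antimono(2)[OF assms]]
    by (auto simp: dini_log_deriv_nth_0 c_def)
  have K': "fps_deriv K = E * K"
  proof -
    have "fps_deriv (dini_fps \<mu>) = - (dini_log_deriv \<mu> * dini_fps \<mu>)"
      by (simp add: dini_log_deriv_mult)
    then show ?thesis
      by (simp add: K_def P_def E_def fps_deriv_inverse_dini_fps) (simp add: algebra_simps)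
  qed
  then have K: "fps_le 0 K"
    using fps_le_log_deriv(1)[of K E K E] E by (simp add: fps_le_def K_def P_def)

  have radP: "ereal R \<le> fps_conv_radius P"
    unfolding P_def R_def using assms by (intro inverse_dini_fps_radius) auto
  have radDP: "ereal R \<le> fps_conv_radius (dini_fps \<mu> * P)"
    using fps_conv_radius_mult[of "dini_fps \<mu>" P] radP assms by (auto intro: order_trans)
  have radK: "ereal R \<le> fps_conv_radius K"
    unfolding K_def using fps_conv_radius_mult[of "dini_fps \<mu> * P" "fps_exp c"] radDP
    by (auto intro: order_trans)
  have radE: "ereal R \<le> fps_conv_radius E"
  proof -
    have "ereal R \<le> min (fps_conv_radius (dini_log_deriv \<nu>)) (fps_conv_radius (dini_log_deriv \<mu>))"
      unfolding R_def using assms by (simp add: dini_log_deriv_radius)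
    also have "\<dots> \<le> fps_conv_radius (dini_log_deriv \<nu> - dini_log_deriv \<mu>)"
      by (rule fps_conv_radius_diff)
    also have "\<dots> \<le> fps_conv_radius E"
      unfolding E_def
      using fps_conv_radius_add[of "dini_log_deriv \<nu> - dini_log_deriv \<mu>" "fps_const c"] by simp
    finally show ?thesis .
  qed

  have inside: "ereal (norm x) < fps_conv_radius F"
    if "ereal R \<le> fps_conv_radius F" "0 < x" "x < R" for x and F :: "real fps"
  proof -
    have "ereal (norm x) < ereal R" using that by simp
    with that(1) show ?thesis by (rule less_le_trans[rotated])
  qed
  have evalK: "eval_fps K x = eval_fps (dini_fps \<mu>) x / eval_fps (dini_fps \<nu>) x * exp (c * x)"
    if x: "0 < x" "x < R" for x
    using inside[OF radP x] inside[OF radDP x] eval_dini_fps_pos(2)[of \<nu> \<nu> x] assms x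
    by (simp add: K_def P_def R_def eval_fps_mult)
  have posK: "eval_fps K x > 0" if x: "0 < x" "x < R" for x
    using x assms eval_dini_fps_pos(1)[of \<nu> \<nu> x] eval_dini_fps_pos(1)[of \<nu> \<mu> x]
    by (simp add: evalK R_def)
  have g: "g_raw \<mu> \<nu> x = C * eval_fps K x" if x: "0 < x" "x < R" for x
  proof -
    \<comment> \<open>The prefactor turns the power of x from d_\<mu> into the one from d_\<nu>, so
      the powers cancel in the quotient.\<close>
    have "x powr ((\<nu> - \<mu>) / 2) * x powr (\<mu> / 2) = x powr (\<nu> / 2)"
      by (simp add: diff_divide_distrib flip: powr_add)
    moreover have "3 * x / 4 * (1 / (\<mu> + 1) - 1 / (\<nu> + 1)) = c * x"
      using assms by (simp add: c_def divide_simps) (simp add: algebra_simps)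
    ultimately have "g_raw \<mu> \<nu> x = dini_const \<mu> * x powr (\<nu> / 2) * exp (c * x) * eval_fps (dini_fps \<mu>) x
        / (dini_const \<nu> * x powr (\<nu> / 2) * eval_fps (dini_fps \<nu>) x)"
      using assms x unfolding g_raw_def by (simp add: dini_sqrt mult_ac)
    then show ?thesis using x by (simp add: evalK C_def)
  qed
  \<comment> \<open>The factor 1 fits the shape \<open>c * eval_fps F x\<close> of the absolute
    monotonicity criterion.\<close>
  have f: "f_raw \<mu> \<nu> x = 1 * eval_fps E x" if x: "0 < x" "x < R" for x
  proof -
    have "(eval_fps K has_real_derivative eval_fps E x * eval_fps K x) (at x)"
      using has_field_derivative_eval_fps[OF inside[OF radK x], of UNIV]
        inside[OF radK x] inside[OF radE x] by (simp add: K' eval_fps_mult)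
    \<comment> \<open>Positivity of \<open>C * eval_fps K x\<close> makes the logarithm
      differentiable, and the constant C drops out of the quotient.\<close>
    then have "((\<lambda>t. ln (C * eval_fps K t)) has_real_derivative eval_fps E x) (at x)"
      using C posK[OF x] by (auto intro!: derivative_eq_intros)
    then have "((\<lambda>t. ln (g_raw \<mu> \<nu> t)) has_real_derivative eval_fps E x) (at x)"
      by (rule has_field_derivative_transform_within_open[where S = "{0<..<R}"])
         (use x in \<open>auto simp: g\<close>)
    then show ?thesis by (simp add: f_raw_def DERIV_imp_deriv)
  qed
  show "absolutely_monotonic_on {0..<(dini_zero1 \<nu>)\<^sup>2} (f_fun \<mu> \<nu>)"
    unfolding f_fun_def R_def[symmetric]
    by (rule absolutely_monotonic_on_ext0_eval_fps[OF E radE _ f]) simp_all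
  show "absolutely_monotonic_on {0..<(dini_zero1 \<nu>)\<^sup>2} (g_fun \<mu> \<nu>)"
    unfolding g_fun_def R_def[symmetric]
    by (rule absolutely_monotonic_on_ext0_eval_fps[OF K radK _ g]) (use C in simp_all)
qed

theorem theorem2:
  fixes \<mu> \<nu> :: real
  assumes "\<nu> > -1" and "\<mu> \<ge> \<nu>"
  shows "absolutely_monotonic_on {0..<(dini_zero1 \<nu>)\<^sup>2} (f_fun \<mu> \<nu>)
       \<and> absolutely_monotonic_on {0..<(dini_zero1 \<nu>)\<^sup>2} (g_fun \<mu> \<nu>)
       \<and> absolutely_monotonic_on {0..<(dini_zero1 \<nu>)\<^sup>2} (q_fun \<nu>)"
  using absolutely_monotonic_f_fun_g_fun[OF assms] absolutely_monotonic_q_fun[OF assms(1)] by blast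

end
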